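(* Let $b>0$, let $f_b$ be the two-valued function on $\mathbb{R}^3$ branched along the parabola $\Gamma_b=\{x_3=0,\ 2bx_1=x_2^2\}$ defined in the context, let $\ell_+:=\{(x_1,0,0):x_1\ge0\}$, and fix $K\Subset\mathbb{R}^3\setminus\ell_+$. For all sufficiently large $R>0$ and every $\mathbf{x}=(x_1,x_2,x_3)\in K$, $$f_b(R\mathbf{x})=\sigma\Bigg[R^2\frac{x_3^2-x_2^2}{2b}+\frac{Rx_1}{2}\log R+R\left\{\frac{|\mathbf{x}|}{2}+x_1\log\left(2\sqrt{\frac{|\mathbf{x}|-x_1}{b}}\right)\right\}-\frac b8\log R+O_{K,b}(1)\Bigg],$$ where $O_{K,b}(1)$ is an error term uniformly bounded on $K$ (independently of $R$), and $\sigma=\operatorname{sgn}(\mu_3)=\pm1$ labels the two values.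
   Context: For $\mathbf{x}=(x_1,x_2,x_3)\in\mathbb{R}^3$ the cubic $Q_{\mathbf{x}}(\lambda)=\lambda^3+(b+2x_1)\lambda^2+(2bx_1-x_2^2-x_3^2)\lambda-bx_3^2$ has three real roots $\lambda_1\le -b\le\lambda_2\le0\le\lambda_3$; put $\mu_3=\pm\sqrt{\lambda_3}$, so that $\mu_3$ is determined up to sign by $\mathbf{x}$. (Writing $\lambda_1=-b-\mu_1^2$, $\lambda_2=-\mu_2^2$, $\lambda_3=\mu_3^2$ gives the modified paraboloidal coordinates $x_1=\frac{\mu_1^2+\mu_2^2-\mu_3^2}{2}$, $x_2=\mu_1\sqrt{(b-\mu_2^2)(b+\mu_3^2)/b}$, $x_3=\mu_2\mu_3\sqrt{(b+\mu_1^2)/b}$, with the deck transformation $(\mu_1,\mu_2,\mu_3)\mapsto(\mu_1,-\mu_2,-\mu_3)$ of a double cover of $\mathbb{R}^3$ branched along $\Gamma_b=\{\mu_2=\mu_3=0\}$.) Define $$f_1(\mu_3)=\int_0^{\mu_3}\frac{dv}{\sqrt{b+v^2}},\quad f_2(\mu_3)=\int_0^{\mu_3}\frac{v^2\,dv}{\sqrt{b+v^2}},\quad f_3(\mu_3)=\int_0^{\mu_3}\frac{dv}{(v^2+b/2)^2\sqrt{b+v^2}},$$ $$P_b(\mathbf{x})=-\frac b8\left(b^2-4bx_1+4x_2^2-4x_3^2\right),\qquad f_b=f_2(\mu_3)+\Big(x_1+\frac b4\Big)f_1(\mu_3)+\frac12P_b(\mathbf{x})f_3(\mu_3).$$ Thus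 $f_b$ is odd in $\mu_3$ and takes two opposite values at each point. $K\Subset U$ means $K$ has compact closure contained in $U$. *)

theory Defs
  imports "HOL-Analysis.Analysis"
begin

definition Qpoly :: "real \<Rightarrow> real^3 \<Rightarrow> real \<Rightarrow> real" where
  "Qpoly b x l = l^3 + (b + 2 * x$1) * l^2 + (2 * b * x$1 - (x$2)^2 - (x$3)^2) * l - b * (x$3)^2"

text \<open>The factorisation identity says that \<open>l1\<close>, \<open>l2\<close>, \<open>l3\<close> are the three roots of the cubic,
  counted with multiplicity.\<close>

definition ordered_roots :: "real \<Rightarrow> real^3 \<Rightarrow> real \<Rightarrow> real \<Rightarrow> real \<Rightarrow> bool" where
  "ordered_roots b x l1 l2 l3 \<longleftrightarrow>
     l1 \<le> -b \<and> -b \<le> l2 \<and> l2 \<le> 0 \<and> 0 \<le> l3 \<and>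
     (\<forall>l. Qpoly b x l = (l - l1) * (l - l2) * (l - l3))"

definition lambda3 :: "real \<Rightarrow> real^3 \<Rightarrow> real" where
  "lambda3 b x = (THE l3. \<exists>l1 l2. ordered_roots b x l1 l2 l3)"

definition mu3_values :: "real \<Rightarrow> real^3 \<Rightarrow> real set" where
  "mu3_values b x = {sqrt (lambda3 b x), - sqrt (lambda3 b x)}"

text \<open>The interval integrals are oriented, so the following three functions are odd in \<open>mu\<close>.\<close>

definition f1 :: "real \<Rightarrow> real \<Rightarrow> real" where
  "f1 b mu = (LBINT v=0..ereal mu. 1 / sqrt (b + v^2))"

definition f2 :: "real \<Rightarrow> real \<Rightarrow> real" where
  "f2 b mu = (LBINT v=0..ereal mu. v^2 / sqrt (b + v^2))"

definition f3 :: "real \<Rightarrow> real \<Rightarrow> real" where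
  "f3 b mu = (LBINT v=0..ereal mu. 1 / ((v^2 + b/2)^2 * sqrt (b + v^2)))"

definition Pb :: "real \<Rightarrow> real^3 \<Rightarrow> real" where
  "Pb b x = - (b/8) * (b^2 - 4 * b * x$1 + 4 * (x$2)^2 - 4 * (x$3)^2)"

text \<open>The two values of the two-valued function at \<open>x\<close> are \<open>fb b x mu\<close> for
  \<open>mu \<in> mu3_values b x\<close>.\<close>

definition fb :: "real \<Rightarrow> real^3 \<Rightarrow> real \<Rightarrow> real" where
  "fb b x mu = f2 b mu + (x$1 + b/4) * f1 b mu + 1/2 * Pb b x * f3 b mu"

definition ell_plus :: "(real^3) set" where
  "ell_plus = {x. x$1 \<ge> 0 \<and> x$2 = 0 \<and> x$3 = 0}"

definition compactly_contained :: "'a::topological_space set \<Rightarrow> 'a set \<Rightarrow> bool" where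
  "compactly_contained K U \<longleftrightarrow> compact (closure K) \<and> closure K \<subseteq> U"

text \<open>For \<open>b > 0\<close> the ordered roots exist and \<open>l3\<close> is unique, so the description in
  \<open>lambda3\<close> denotes.\<close>

lemma cubic_nonneg:
  fixes p q r M :: real
  assumes "M = 1 + \<bar>p\<bar> + \<bar>q\<bar> + \<bar>r\<bar>"
  shows "M^3 + p * M^2 + q * M + r \<ge> 0"
proof -
  have M: "M \<ge> 1" using assms by simp
  have M2: "M \<le> M^2" "1 \<le> M^2"
    using M by (simp_all add: power2_eq_square mult_le_cancel_left1 one_le_power)
       (metis M mult_mono' mult_1 zero_le_one)
  have 1: "p * M^2 \<ge> - \<bar>p\<bar> * M^2" by (intro mult_right_mono) auto
  have "q * M \<ge> - \<bar>q\<bar> * M" using M by (intro mult_right_mono) auto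
  moreover have "\<bar>q\<bar> * M \<le> \<bar>q\<bar> * M^2" using M2 by (intro mult_left_mono) auto
  ultimately have 2: "q * M \<ge> - \<bar>q\<bar> * M^2" by simp
  have "\<bar>r\<bar> * 1 \<le> \<bar>r\<bar> * M^2" using M2 by (intro mult_left_mono) auto
  then have 3: "r \<ge> - \<bar>r\<bar> * M^2" by simp
  have "M^3 = M * M^2" by (simp add: power2_eq_square power3_eq_cube)
  also have "\<dots> = (1 + \<bar>p\<bar> + \<bar>q\<bar> + \<bar>r\<bar>) * M^2" using assms by simp
  finally have "M^3 = M^2 + \<bar>p\<bar> * M^2 + \<bar>q\<bar> * M^2 + \<bar>r\<bar> * M^2" by (simp add: algebra_simps)
  then show ?thesis using 1 2 3 M2 by simp
qed

lemma ordered_roots_exist: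
  assumes b: "b > 0"
  shows "\<exists>l1 l2 l3. ordered_roots b x l1 l2 l3"
proof -
  define p where "p = b + 2 * x$1"
  define q where "q = 2 * b * x$1 - (x$2)^2 - (x$3)^2"
  define r where "r = - b * (x$3)^2"
  have Q: "Qpoly b x l = l^3 + p * l^2 + q * l + r" for l
    by (simp add: Qpoly_def p_def q_def r_def)
  have cont: "continuous_on S (Qpoly b x)" for S
    unfolding Q[abs_def] by (intro continuous_intros)
  have Q0: "Qpoly b x 0 \<le> 0" using b by (simp add: Qpoly_def)
  have "Qpoly b x (-b) = b * (x$2)^2"
    by (simp add: Qpoly_def power2_eq_square power3_eq_cube algebra_simps)
  then have Qb: "Qpoly b x (-b) \<ge> 0" using b by simp
  define M where "M = 1 + \<bar>p\<bar> + \<bar>q\<bar> + \<bar>r\<bar>"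
  have QM: "Qpoly b x M \<ge> 0" unfolding Q by (rule cubic_nonneg) (simp add: M_def)
  have M0: "0 \<le> M" by (simp add: M_def)
  obtain l3 where l3: "0 \<le> l3" "Qpoly b x l3 = 0"
    using IVT'[OF Q0 QM M0 cont] by auto
  have "\<exists>l\<le>-b. Qpoly b x l = 0"
  proof -
    define p' where "p' = \<bar>p\<bar> + b"
    define L where "L = 1 + \<bar>-p'\<bar> + \<bar>q\<bar> + \<bar>-r\<bar>"
    have "L^3 + (-p') * L^2 + q * L + (-r) \<ge> 0" by (rule cubic_nonneg) (simp add: L_def)
    moreover have "p * L^2 \<le> p' * L^2" using b by (intro mult_right_mono) (auto simp: p'_def)
    ultimately have QL: "Qpoly b x (-L) \<le> 0" unfolding Q by (simp add: power3_eq_cube)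
    have "-L \<le> -b" using b by (simp add: L_def p'_def)
    from IVT'[OF QL Qb this cont] show ?thesis by auto
  qed
  then obtain l1 where l1: "l1 \<le> -b" "Qpoly b x l1 = 0" by auto
  have ne: "l1 \<noteq> l3" using l1 l3 b by simp
  define l2 where "l2 = - p - l1 - l3"
  have "(l1 - l3) * (l1^2 + l1*l3 + l3^2 + p * (l1 + l3) + q) = Qpoly b x l1 - Qpoly b x l3"
    unfolding Q by (simp add: power2_eq_square power3_eq_cube algebra_simps)
  then have q_eq: "q = - (l1^2 + l1*l3 + l3^2 + p * (l1 + l3))" using ne l1 l3 by auto
  have r_eq: "r = - (l3^3 + p * l3^2 + q * l3)" using l3 Q by simp
  have fac: "Qpoly b x l = (l - l1) * (l - l2) * (l - l3)" for l
    unfolding Q r_eq q_eq l2_def by (simp add: power2_eq_square power3_eq_cube algebra_simps)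
  consider "l2 < -b" | "l2 > 0" | "-b \<le> l2" "l2 \<le> 0" by linarith
  then show ?thesis
  proof cases
    case 1
    have "l1 = -b"
    proof (rule ccontr)
      assume "l1 \<noteq> -b"
      then have "(-b - l1) * (-b - l2) > 0" using l1 1 by simp
      then have "(-b - l1) * (-b - l2) * (-b - l3) < 0" using b l3 by (intro mult_pos_neg) auto
      then show False using Qb fac by simp
    qed
    then have "ordered_roots b x l2 (-b) l3"
      unfolding ordered_roots_def using 1 b l3 fac by simp
    then show ?thesis by blast
  next
    case 2
    have "l3 = 0"
    proof (rule ccontr)
      assume "l3 \<noteq> 0"
      then have "(- l1) * l2 * l3 > 0" using l1 l3 2 b by (intro mult_pos_pos) auto
      then show False using Q0 fac[of 0] by simp
    qed
    then have "ordered_roots b x l1 0 l2"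
      unfolding ordered_roots_def using 2 b l1 fac by simp
    then show ?thesis by blast
  next
    case 3
    then have "ordered_roots b x l1 l2 l3"
      unfolding ordered_roots_def using l1 l3 fac by simp
    then show ?thesis by blast
  qed
qed

lemma ordered_roots_unique3:
  assumes "ordered_roots b x l1 l2 l3" "ordered_roots b x k1 k2 k3" "b > 0"
  shows "l3 = k3"
proof -
  have "(l3 - k1) * (l3 - k2) * (l3 - k3) = 0" "(k3 - l1) * (k3 - l2) * (k3 - l3) = 0"
    using assms unfolding ordered_roots_def by (metis diff_self mult_zero_right)+
  then show ?thesis using assms unfolding ordered_roots_def by auto
qed

lemma lambda3_ordered_roots:
  assumes "b > 0"
  shows "\<exists>l1 l2. ordered_roots b x l1 l2 (lambda3 b x)"
proof -
  have "\<exists>!l3. \<exists>l1 l2. ordered_roots b x l1 l2 l3"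
    using ordered_roots_exist[OF assms] ordered_roots_unique3[OF _ _ assms] by metis
  then show ?thesis unfolding lambda3_def by (rule theI')
qed

end

theory Submission imports Defs begin

text \<open>
  The three integrals are elementary: \<open>f1\<close> is an \<open>arsinh\<close>, and with \<open>s = sqrt (b + \<mu>\<^sup>2)\<close> both
  \<open>f2\<close> (up to a multiple of \<open>f1\<close>) and \<open>f3\<close> are algebraic in \<open>\<mu>\<close> and \<open>s\<close>. This gives a closed form
  of \<open>fb\<close> in terms of \<open>x\<close> and \<open>\<mu>\<close> (\<open>fb_closed_form\<close>), and reduces the claim to locating the root
  \<open>\<lambda> = \<mu>\<^sup>2\<close>.

  The cubic is a perturbation of a cubic with explicit roots:
  \<open>Q(l) = (l + b) (l - a) (l + a') + b x\<^sub>2\<^sup>2\<close> with \<open>a = |x| - x\<^sub>1\<close> and \<open>a' = |x| + x\<^sub>1\<close>. Since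
  \<open>x\<^sub>2\<^sup>2 \<le> a a'\<close>, sign considerations at \<open>a - b\<close> and beyond \<open>a\<close> show that the nonnegative root
  satisfies \<open>a - b \<le> \<lambda> \<le> a\<close> as soon as \<open>a \<ge> b\<close> (\<open>lambda3_bounds\<close>).

  Inserting this localisation into the closed form replaces \<open>\<lambda>\<close> by \<open>a\<close> at the cost of an error that
  is at most \<open>b (1 + |x| / a)\<^sup>2\<close> (\<open>fb_explicit_estimate\<close>). The bound is invariant under scaling of \<open>x\<close>,
  so along the ray \<open>R x\<close> it does not grow. The half-line \<open>ell_plus\<close> is exactly the set where
  \<open>|x| - x\<^sub>1\<close> vanishes; on a compact set that avoids it, \<open>|x| / a\<close> and \<open>|ln a|\<close> are bounded, which
  yields uniformity, and for large \<open>R\<close> one has \<open>R a \<ge> 2 b\<close>. The other sign of \<open>\<mu>\<close> follows because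
  \<open>fb\<close> is odd in \<open>\<mu>\<close>.
\<close>

section \<open>Closed forms of the defining integrals\<close>

lemma has_real_derivative_mult_sqrt_quadratic:
  fixes b v :: real
  assumes "b > 0"
  shows "((\<lambda>v. v * sqrt (b + v^2)) has_real_derivative
    v * (v / sqrt (b + v^2)) + sqrt (b + v^2)) (at v)"
proof -
  have "b + v^2 > 0" using assms by (simp add: add_pos_nonneg)
  then show ?thesis by (auto intro!: derivative_eq_intros simp: field_simps)
qed

lemma interval_integral_eq_antiderivative:
  fixes F g :: "real \<Rightarrow> real" and a c :: real
  assumes "\<And>v. (F has_real_derivative g v) (at v)"
    and "continuous_on UNIV g"
  shows "(LBINT v=a..c. g v) = F c - F a"
proof (rule interval_integral_FTC_finite)
  show "continuous_on {min a c..max a c} g"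
    using assms(2) continuous_on_subset by blast
  show "(F has_vector_derivative g v) (at v within {min a c..max a c})" for v
    by (metis assms(1) has_field_derivative_at_within has_real_derivative_iff_has_vector_derivative)
qed

lemma has_real_derivative_arsinh_scaled:
  fixes b v :: real
  assumes "b > 0"
  shows "((\<lambda>v. arsinh (v / sqrt b)) has_real_derivative 1 / sqrt (b + v^2)) (at v)"
proof -
  have "sqrt b * sqrt ((v / sqrt b)^2 + 1) = sqrt (b + v^2)"
    using assms by (simp add: power_divide field_simps flip: real_sqrt_mult)
  then have "1 / sqrt ((v / sqrt b)^2 + 1) * (1 / sqrt b) = 1 / sqrt (b + v^2)"
    by (simp add: mult.commute)
  then show ?thesis
    using DERIV_chain2[where f = arsinh, OF arsinh_real_has_field_derivative
        DERIV_cdivide[where c = "sqrt b", OF DERIV_ident[of "at v"]]]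
    by simp
qed

lemma f1_eq_arsinh:
  assumes "b > 0"
  shows "f1 b mu = arsinh (mu / sqrt b)"
proof -
  have pos: "b + v^2 > 0" for v using assms by (simp add: add_pos_nonneg)
  have "continuous_on UNIV (\<lambda>v. 1 / sqrt (b + v^2))"
    using pos by (intro continuous_intros) (simp add: less_imp_neq[symmetric])
  from interval_integral_eq_antiderivative[OF has_real_derivative_arsinh_scaled[OF assms] this,
      of 0 mu]
  show ?thesis by (simp add: f1_def zero_ereal_def)
qed

lemma f2_eq:
  assumes "b > 0"
  shows "f2 b mu = mu * sqrt (b + mu^2) / 2 - b / 2 * f1 b mu"
proof -
  have pos: "b + v^2 > 0" for v using assms by (simp add: add_pos_nonneg)
  have der1: "(f1 b has_real_derivative 1 / sqrt (b + v^2)) (at v)" for v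
    unfolding f1_eq_arsinh[OF assms, abs_def] by (rule has_real_derivative_arsinh_scaled[OF assms])
  have der: "((\<lambda>v. v * sqrt (b + v^2) / 2 - b / 2 * f1 b v) has_real_derivative
      v^2 / sqrt (b + v^2)) (at v)" for v
  proof -
    have sq: "sqrt (b + v^2) * sqrt (b + v^2) = b + v^2"
      using pos[of v] by simp
    have eq: "(v * (v / sqrt (b + v^2)) + sqrt (b + v^2)) / 2 - b / 2 * (1 / sqrt (b + v^2))
      = v^2 / sqrt (b + v^2)"
      using pos[of v] sq by (simp add: field_simps power2_eq_square)
    show ?thesis
      by (rule DERIV_cong[OF DERIV_diff[OF
            DERIV_cdivide[OF has_real_derivative_mult_sqrt_quadratic[OF assms]]
            DERIV_cmult[OF der1]] eq])
  qed
  have "continuous_on UNIV (\<lambda>v. v^2 / sqrt (b + v^2))"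
    using pos by (intro continuous_intros) (simp add: less_imp_neq[symmetric])
  from interval_integral_eq_antiderivative[OF der this, of 0 mu]
  show ?thesis using assms by (simp add: f2_def f1_eq_arsinh zero_ereal_def)
qed

text \<open>The substitution \<open>t = v / sqrt (b + v^2)\<close> turns the integrand into
  \<open>4 / b^2 * (1 - t^2) / (1 + t^2)^2\<close>, the derivative of \<open>4 / b^2 * (t / (1 + t^2))\<close>; this is where
  the right-hand side comes from. It is verified below by differentiation.\<close>

lemma f3_eq:
  assumes "b > 0"
  shows "f3 b mu = 4 / b^2 * (mu * sqrt (b + mu^2) / (b + 2 * mu^2))"
proof -
  have pos: "b + v^2 > 0" "b + 2 * v^2 > 0" "v^2 + b / 2 > 0" for v
    using assms by (simp_all add: add_pos_nonneg add_nonneg_pos)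
  have der: "((\<lambda>v. 4 / b^2 * (v * sqrt (b + v^2) / (b + 2 * v^2))) has_real_derivative
      1 / ((v^2 + b/2)^2 * sqrt (b + v^2))) (at v)" for v
  proof -
    define s where "s = sqrt (b + v^2)"
    have s: "s > 0" "s^2 = b + v^2" using pos[of v] by (auto simp: s_def)
    have half: "v^2 + b/2 = (b + 2 * v^2) / 2" by simp
    have num: "(v * (v / s) + s) * (b + 2 * v^2) - v * s * (4 * v) = b^2 / s"
    proof -
      have "((v * v + s^2) * (b + 2 * v^2) - 4 * v^2 * s^2) = b^2"
        unfolding s by (simp add: power2_eq_square algebra_simps)
      then show ?thesis using s(1) by (simp add: field_simps power2_eq_square)
    qed
    have "4 / b^2 * (((v * (v / s) + s) * (b + 2 * v^2) - v * s * (4 * v)) / (b + 2 * v^2)^2)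
      = 1 / ((v^2 + b/2)^2 * s)"
      unfolding num half using assms s pos[of v] by (simp add: field_simps)
    then have eq: "4 / b^2 * (((v * (v / sqrt (b + v^2)) + sqrt (b + v^2)) * (b + 2 * v^2)
        - v * sqrt (b + v^2) * (4 * v)) / ((b + 2 * v^2) * (b + 2 * v^2)))
      = 1 / ((v^2 + b/2)^2 * sqrt (b + v^2))"
      by (simp add: s_def power2_eq_square)
    show ?thesis
      unfolding eq[symmetric] using pos(2)[of v]
      by (intro DERIV_cmult DERIV_divide has_real_derivative_mult_sqrt_quadratic[OF assms])
         (auto intro!: derivative_eq_intros)
  qed
  have "continuous_on UNIV (\<lambda>v. 1 / ((v^2 + b/2)^2 * sqrt (b + v^2)))"
    using pos by (intro continuous_intros) (simp add: less_imp_neq[symmetric])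
  from interval_integral_eq_antiderivative[OF der this, of 0 mu]
  show ?thesis by (simp add: f3_def zero_ereal_def)
qed

lemma fb_closed_form:
  assumes "b > 0"
  shows "fb b x mu = mu * sqrt (b + mu^2) / 2 + (x$1 - b/4) * arsinh (mu / sqrt b)
    - (b^2 - 4 * b * x$1 + 4 * (x$2)^2 - 4 * (x$3)^2) / (4 * b)
      * (mu * sqrt (b + mu^2) / (b + 2 * mu^2))"
proof -
  define S where "S = mu * sqrt (b + mu^2) / 2"
  define A where "A = arsinh (mu / sqrt b)"
  define D where "D = (b^2 - 4 * b * x$1 + 4 * (x$2)^2 - 4 * (x$3)^2) / (4 * b)"
  define T where "T = mu * sqrt (b + mu^2) / (b + 2 * mu^2)"
  have coeff: "1/2 * Pb b x * (4 / b^2) = - D"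
    using assms by (simp add: Pb_def D_def field_simps power2_eq_square)
  have "fb b x mu = (S - b / 2 * A) + (x$1 + b/4) * A + 1/2 * Pb b x * (4 / b^2 * T)"
    by (simp only: fb_def f2_eq[OF assms] f1_eq_arsinh[OF assms] f3_eq[OF assms] S_def A_def T_def)
  also have "1/2 * Pb b x * (4 / b^2 * T) = - D * T"
    by (simp only: coeff flip: mult.assoc)
  also have "(S - b / 2 * A) + (x$1 + b/4) * A + - D * T = S + (x$1 - b/4) * A - D * T"
    by (simp add: algebra_simps)
  finally show ?thesis unfolding S_def A_def D_def T_def .
qed

lemma fb_odd:
  assumes "b > 0"
  shows "fb b x (- mu) = - fb b x mu"
  by (simp add: fb_closed_form[OF assms] arsinh_minus_real)

section \<open>Localisation of the nonnegative root\<close>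

lemma norm_vec3_squared:
  fixes x :: "real^3"
  shows "(norm x)^2 = (x$1)^2 + (x$2)^2 + (x$3)^2"
  by (simp add: norm_vec_def L2_set_def sum_3)

text \<open>The last two factors multiply to \<open>l^2 + 2 * x$1 * l - (x$2)^2 - (x$3)^2\<close>. This form isolates
  the part of the cubic that moves its roots away from \<open>- b\<close> and the two roots of that
  quadratic.\<close>

lemma Qpoly_eq_shifted_product:
  "Qpoly b x l = (l + b) * (l - (norm x - x$1)) * (l + (norm x + x$1)) + b * (x$2)^2"
proof -
  have "(l - (norm x - x$1)) * (l + (norm x + x$1)) = l^2 + 2 * x$1 * l + (x$1)^2 - (norm x)^2"
    by (simp add: power2_eq_square algebra_simps)
  also have "\<dots> = l^2 + 2 * x$1 * l - (x$2)^2 - (x$3)^2"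
    by (simp add: norm_vec3_squared)
  finally show ?thesis
    by (simp add: mult.assoc Qpoly_def) (simp add: power2_eq_square power3_eq_cube algebra_simps)
qed

text \<open>The cubic is positive to the right of its largest root. At \<open>norm x - x$1 - b\<close> it is
  nonpositive, because \<open>(x$2)^2 \<le> (norm x - x$1) * (norm x + x$1)\<close> keeps the perturbation below the
  product; this gives the lower bound. For the upper bound, both summands of the shifted product are
  nonnegative, and the first one positive, beyond \<open>norm x - x$1\<close>.\<close>

lemma lambda3_bounds:
  assumes "b > 0" and "b \<le> norm x - x$1"
  shows "norm x - x$1 - b \<le> lambda3 b x" and "lambda3 b x \<le> norm x - x$1"
proof -
  define a where "a = norm x - x$1"
  define c where "c = norm x + x$1"
  obtain l1 l2 where l: "ordered_roots b x l1 l2 (lambda3 b x)"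
    using lambda3_ordered_roots[OF assms(1)] by blast
  have fac: "Qpoly b x t = (t - l1) * (t - l2) * (t - lambda3 b x)" for t
    using l by (simp add: ordered_roots_def)
  have shifted: "Qpoly b x t = (t + b) * (t - a) * (t + c) + b * (x$2)^2" for t
    by (simp add: Qpoly_eq_shifted_product a_def c_def)
  have "a \<ge> b" "c \<ge> 0"
    using assms component_le_norm_cart[of x 1] by (auto simp: a_def c_def)
  have "a * c = (norm x)^2 - (x$1)^2"
    by (simp add: a_def c_def power2_eq_square algebra_simps)
  then have x2: "(x$2)^2 \<le> a * c"
    by (simp add: norm_vec3_squared)
  show "norm x - x$1 - b \<le> lambda3 b x"
  proof (rule ccontr)
    assume "\<not> ?thesis"
    then have "Qpoly b x (a - b) > 0"
      unfolding fac using l by (auto simp: a_def ordered_roots_def intro!: mult_pos_pos)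
    moreover have "Qpoly b x (a - b) \<le> - (a * b * (a - b))"
      unfolding shifted using mult_left_mono[OF x2, of b] \<open>b > 0\<close> by (simp add: algebra_simps)
    moreover have "a * b * (a - b) \<ge> 0"
      using \<open>a \<ge> b\<close> \<open>b > 0\<close> by simp
    ultimately show False by simp
  qed
  show "lambda3 b x \<le> norm x - x$1"
  proof (rule ccontr)
    assume "\<not> ?thesis"
    then have "(lambda3 b x + b) * (lambda3 b x - a) * (lambda3 b x + c) > 0"
      using \<open>a \<ge> b\<close> \<open>c \<ge> 0\<close> \<open>b > 0\<close> by (intro mult_pos_pos) (auto simp: a_def)
    moreover have "b * (x$2)^2 \<ge> 0" using \<open>b > 0\<close> by simp
    ultimately have "Qpoly b x (lambda3 b x) > 0"
      unfolding shifted by linarith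
    then show False by (simp add: fac)
  qed
qed

section \<open>Replacing the root by its leading term\<close>

lemma sqrt_mult_sqrt_add_bounds:
  fixes b l :: real
  assumes "b \<ge> 0" "l \<ge> 0"
  shows "l \<le> sqrt l * sqrt (b + l)" and "sqrt l * sqrt (b + l) \<le> l + b / 2"
proof -
  have "sqrt l * sqrt l \<le> sqrt l * sqrt (b + l)"
    using assms by (intro mult_left_mono) auto
  then show "l \<le> sqrt l * sqrt (b + l)" using assms by simp
  show "sqrt l * sqrt (b + l) \<le> l + b / 2"
    using arith_geo_mean_sqrt[of l "b + l"] assms by (simp add: field_simps flip: real_sqrt_mult)
qed

text \<open>The assumption \<open>2 * d \<le> z\<close> forces \<open>z / 2 \<le> y\<close>, so the slope of the logarithm between \<open>y\<close> and \<open>z\<close>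
  is at most \<open>2 / z\<close>.\<close>

lemma abs_ln_diff_le:
  fixes y z d :: real
  assumes "\<bar>y - z\<bar> \<le> d" "2 * d \<le> z" "z > 0"
  shows "\<bar>ln y - ln z\<bar> \<le> 2 * d / z"
proof -
  have "y > 0" using assms by linarith
  have "ln y - ln z \<le> (y - z) / z"
    using ln_diff_le[of y z] \<open>y > 0\<close> assms by simp
  also have "\<dots> \<le> 2 * d / z"
    using assms by (intro divide_right_mono) auto
  finally have upper: "ln y - ln z \<le> 2 * d / z" .
  have "ln z - ln y \<le> (z - y) / y"
    using ln_diff_le[of z y] \<open>y > 0\<close> assms by simp
  also have "\<dots> \<le> d / (z / 2)"
    using assms \<open>y > 0\<close> by (intro frac_le) auto
  finally have "ln z - ln y \<le> 2 * d / z" by (simp add: mult.commute)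
  with upper show ?thesis by linarith
qed

text \<open>Squaring the argument of the logarithm in \<open>arsinh\<close> gives
  \<open>(2 * l + b + 2 * sqrt l * sqrt (b + l)) / b\<close>, whose numerator differs from \<open>4 * a\<close> by at most
  \<open>4 * b\<close>. The relative error of the numerator is thus of order \<open>b / a\<close>; its smallness matters because
  the \<open>arsinh\<close> is multiplied by \<open>x$1\<close> in \<open>fb\<close>.\<close>

lemma arsinh_sqrt_asymp:
  fixes a b l :: real
  assumes "b > 0" "a - b \<le> l" "l \<le> a" "2 * b \<le> a"
  shows "\<bar>arsinh (sqrt l / sqrt b) - ln (4 * a / b) / 2\<bar> \<le> b / a"
proof -
  have "l > 0" "a > 0" using assms by auto
  define y where "y = 2 * l + b + 2 * (sqrt l * sqrt (b + l))"
  have "\<bar>y - 4 * a\<bar> \<le> 4 * b"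
    using sqrt_mult_sqrt_add_bounds[of b l] \<open>l > 0\<close> assms unfolding y_def by linarith
  then have ln_y: "\<bar>ln y - ln (4 * a)\<bar> \<le> 2 * (b / a)"
    using abs_ln_diff_le[of y "4 * a" "4 * b"] assms \<open>a > 0\<close> by simp
  have "sqrt ((sqrt l / sqrt b)^2 + 1) = sqrt (b + l) / sqrt b"
    using \<open>l > 0\<close> \<open>b > 0\<close> by (simp add: power_divide add_divide_distrib flip: real_sqrt_divide)
  then have "arsinh (sqrt l / sqrt b) = ln ((sqrt l + sqrt (b + l)) / sqrt b)"
    by (simp add: arsinh_real_def add_divide_distrib)
  also have "\<dots> = ln (((sqrt l + sqrt (b + l)) / sqrt b)^2) / 2"
    using \<open>l > 0\<close> \<open>b > 0\<close> by (simp add: ln_realpow add_pos_pos)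
  also have "((sqrt l + sqrt (b + l)) / sqrt b)^2 = y / b"
    using \<open>l > 0\<close> \<open>b > 0\<close> by (simp add: power_divide power2_sum y_def)
  finally have "arsinh (sqrt l / sqrt b) = ln (y / b) / 2" .
  moreover have "y > 0"
    using \<open>l > 0\<close> \<open>b > 0\<close> by (simp add: y_def add_pos_nonneg)
  ultimately have "arsinh (sqrt l / sqrt b) = (ln y - ln b) / 2"
    using \<open>b > 0\<close> by (simp add: ln_div)
  moreover have "ln (4 * a / b) = ln (4 * a) - ln b"
    using \<open>a > 0\<close> \<open>b > 0\<close> by (simp add: ln_div)
  ultimately have "arsinh (sqrt l / sqrt b) - ln (4 * a / b) / 2 = (ln y - ln (4 * a)) / 2"
    by (simp add: diff_divide_distrib)
  then show ?thesis using ln_y by simp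
qed

text \<open>The quotient is multiplied by a quadratic polynomial in \<open>x\<close> in \<open>fb\<close>, so its limit \<open>1/2\<close> has to be
  approached with an error of second order. There is no first-order term because the square of the
  quotient is exactly \<open>1/4 - b^2 / (4 * (b + 2 * l)^2)\<close>.\<close>

lemma half_minus_quotient_bounds:
  fixes a b l :: real
  assumes "b > 0" "a - b \<le> l" "2 * b \<le> a"
  shows "\<bar>1/2 - sqrt l * sqrt (b + l) / (b + 2 * l)\<bar> \<le> b^2 / (2 * a^2)"
proof -
  define t where "t = sqrt l * sqrt (b + l) / (b + 2 * l)"
  have l: "l > 0" "a > 0" "a \<le> b + 2 * l" using assms by auto
  have t0: "t \<ge> 0" using l assms by (simp add: t_def)
  have "t \<le> (l + b / 2) / (b + 2 * l)"
    unfolding t_def using sqrt_mult_sqrt_add_bounds[of b l] l assms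
    by (intro divide_right_mono) auto
  also have "\<dots> = 1/2" using l assms by (simp add: field_simps)
  finally have t1: "t \<le> 1/2" .
  have "t^2 = l * (b + l) / (b + 2 * l)^2"
    using l assms by (simp add: t_def power_divide power_mult_distrib)
  also have "l * (b + l) = ((b + 2 * l)^2 - b^2) / 4"
    by (simp add: power2_eq_square algebra_simps)
  also have "\<dots> / (b + 2 * l)^2 = 1/4 - b^2 / (4 * (b + 2 * l)^2)"
    using l assms by (simp add: diff_divide_distrib)
  finally have "(1/2 - t) * (1/2 + t) = b^2 / (4 * (b + 2 * l)^2)"
    by (simp add: power2_eq_square algebra_simps)
  moreover have "(1/2 - t) * (1/2) \<le> (1/2 - t) * (1/2 + t)"
    using t0 t1 by (intro mult_left_mono) auto
  moreover have "b^2 / (4 * (b + 2 * l)^2) \<le> b^2 / (4 * a^2)"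
    using l by (intro divide_left_mono mult_left_mono power_mono) auto
  ultimately have "1/2 - t \<le> b^2 / (2 * a^2)" by simp
  then show ?thesis using t1 by (simp add: t_def)
qed

text \<open>Each of the three terms of the closed form is compared with its value at \<open>\<lambda> = a\<close> to leading
  order. The errors contribute \<open>b / 2\<close>, \<open>b q + b / 8\<close> and \<open>b / 8 * (1/2 + 2 q)\<^sup>2\<close> with
  \<open>q = norm x / a\<close>, and the constant term \<open>b^2\<close> in \<open>Pb\<close> gives a further \<open>b / 8\<close>.
  The linear terms \<open>a / 2\<close> from the first summand and \<open>x$1 / 2\<close> from the last one add up to \<open>norm x / 2\<close>.\<close>

lemma fb_explicit_estimate:
  fixes x :: "real^3"
  defines "a \<equiv> norm x - x$1"
  assumes "b > 0" and "2 * b \<le> a"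
  shows "\<bar>fb b x (sqrt (lambda3 b x))
      - (((x$3)^2 - (x$2)^2) / (2 * b) + norm x / 2 + (x$1 - b/4) * (ln (4 * a / b) / 2))\<bar>
    \<le> b * (1 + norm x / a)^2"
proof -
  define l where "l = lambda3 b x"
  have l: "a - b \<le> l" "l \<le> a"
    using lambda3_bounds[of b x] assms by (auto simp: l_def)
  have pos: "l > 0" "a > 0" using l assms by auto
  define N where "N = norm x"
  define q where "q = N / a"
  define S where "S = sqrt l * sqrt (b + l)"
  define A where "A = arsinh (sqrt l / sqrt b) - ln (4 * a / b) / 2"
  define T where "T = 1/2 - S / (b + 2 * l)"
  define D where "D = b^2 - 4 * b * x$1 + 4 * (x$2)^2 - 4 * (x$3)^2"
  define c where "c = x$1 - b/4"
  define k where "k = D / (4 * b)"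
  have q0: "q \<ge> 0" "N \<ge> 0" using pos by (auto simp: q_def N_def)
  have ba: "b / a \<le> 1/2" "b / a \<ge> 0" using assms pos by (auto simp: field_simps)
  have x1: "\<bar>x$1\<bar> \<le> N" unfolding N_def by (rule component_le_norm_cart)

  have err_S: "\<bar>(S - a) / 2\<bar> \<le> b / 2"
    using sqrt_mult_sqrt_add_bounds[of b l] l pos \<open>b > 0\<close>
    unfolding S_def abs_le_iff by (auto simp: field_simps)

  have err_A: "\<bar>c * A\<bar> \<le> b * q + b / 8"
  proof -
    have "\<bar>x$1 - b/4\<bar> * \<bar>A\<bar> \<le> (N + b/4) * (b / a)"
      unfolding A_def using arsinh_sqrt_asymp[of b a l] l assms x1
      by (intro mult_mono) auto
    also have "\<dots> = b * q + b / 4 * (b / a)"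
      by (simp add: q_def algebra_simps)
    also have "\<dots> \<le> b * q + b / 4 * (1/2)"
      using ba \<open>b > 0\<close> by (intro add_left_mono mult_left_mono) auto
    finally show ?thesis by (simp add: c_def abs_mult)
  qed

  have err_T: "\<bar>k * T\<bar> \<le> b / 8 * (1/2 + 2 * q)^2"
  proof -
    have "(x$2)^2 \<le> N^2" "(x$3)^2 \<le> N^2" "(x$2)^2 \<ge> 0" "(x$3)^2 \<ge> 0"
      by (auto simp: N_def norm_vec3_squared)
    moreover have "\<bar>b * x$1\<bar> \<le> b * N"
      using x1 \<open>b > 0\<close> by (simp add: abs_mult)
    moreover have "b^2 \<ge> 0" by simp
    moreover have "4 * b * x$1 = 4 * (b * x$1)" by simp
    ultimately have "\<bar>D\<bar> \<le> b^2 + 4 * (b * N) + 4 * N^2"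
      unfolding D_def by linarith
    also have "\<dots> = (b + 2 * N)^2" by (simp add: power2_eq_square algebra_simps)
    finally have D: "\<bar>D\<bar> \<le> (b + 2 * N)^2" .
    have "\<bar>T\<bar> \<le> b^2 / (2 * a^2)"
      unfolding T_def S_def using half_minus_quotient_bounds[of b a l] l assms by simp
    then have "\<bar>D\<bar> / (4 * b) * \<bar>T\<bar> \<le> (b + 2 * N)^2 / (4 * b) * (b^2 / (2 * a^2))"
      using D \<open>b > 0\<close> by (intro mult_mono divide_right_mono) auto
    also have "\<dots> = b / 8 * (b / a + 2 * q)^2"
      using pos \<open>b > 0\<close> by (simp add: q_def field_simps power2_eq_square)
    also have "\<dots> \<le> b / 8 * (1/2 + 2 * q)^2"
      using ba q0 \<open>b > 0\<close> by (intro mult_left_mono power_mono) auto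
    finally show ?thesis using \<open>b > 0\<close> by (simp add: k_def abs_mult)
  qed

  have quadratic: "((x$3)^2 - (x$2)^2) / (2 * b) = b / 8 - x$1 / 2 - k / 2"
    using \<open>b > 0\<close> by (simp add: k_def D_def field_simps power2_eq_square)
  have closed: "fb b x (sqrt l) = S / 2 + c * arsinh (sqrt l / sqrt b) - k * (S / (b + 2 * l))"
    using pos \<open>b > 0\<close> by (simp add: fb_closed_form S_def D_def c_def k_def)
  have "N = a + x$1" by (simp add: N_def a_def)
  then have "fb b x (sqrt l)
      - (((x$3)^2 - (x$2)^2) / (2 * b) + N / 2 + c * (ln (4 * a / b) / 2))
    = (S - a) / 2 + c * A + k * T - b / 8"
    unfolding quadratic closed A_def T_def right_diff_distrib by (simp add: field_simps)
  moreover have "b / 2 + (b * q + b / 8) + b / 8 * (1/2 + 2 * q)^2 + b / 8 \<le> b * (1 + q)^2"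
  proof -
    have "b * (1 + q)^2 - (b / 2 + (b * q + b / 8) + b / 8 * (1/2 + 2 * q)^2 + b / 8)
      = b * (7 / 32 + 3 / 4 * q + q^2 / 2)"
      by (simp add: power2_eq_square algebra_simps)
    also have "\<dots> \<ge> 0" using \<open>b > 0\<close> q0 by simp
    finally show ?thesis by simp
  qed
  ultimately show ?thesis
    using err_S err_A err_T \<open>b > 0\<close>
    unfolding l_def[symmetric] N_def[symmetric] q_def[symmetric] c_def[symmetric]
    by linarith
qed

section \<open>Uniformity on compact sets\<close>

text \<open>By the equality case of \<open>x$1 \<le> norm x\<close>, the continuous function \<open>norm x - x$1\<close> vanishes only
  on \<open>ell_plus\<close>, so it has a positive minimum on the closure of \<open>K\<close>.\<close>

lemma compactly_contained_ell_plus_complement_bounds: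
  assumes "compactly_contained K (UNIV - ell_plus)"
  obtains d B where "d > 0" "\<And>x. x \<in> K \<Longrightarrow> d \<le> norm x - x$1" "\<And>x. x \<in> K \<Longrightarrow> norm x \<le> B"
proof -
  have comp: "compact (closure K)" and sub: "closure K \<subseteq> UNIV - ell_plus"
    using assms by (auto simp: compactly_contained_def)
  have pos: "norm x - x$1 > 0" if "x \<in> closure K" for x :: "real^3"
  proof (rule ccontr)
    assume "\<not> ?thesis"
    then have eq: "x$1 = norm x"
      using component_le_norm_cart[of x 1] by simp
    with norm_vec3_squared[of x] have "(x$2)^2 + (x$3)^2 = 0" by simp
    then have "x \<in> ell_plus"
      using eq by (simp add: ell_plus_def sum_power2_eq_zero_iff)
    with that sub show False by blast
  qed
  obtain B where B: "\<And>x. x \<in> closure K \<Longrightarrow> norm x \<le> B"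
    using compact_imp_bounded[OF comp] by (auto simp: bounded_iff)
  show ?thesis
  proof (cases "closure K = {}")
    case True
    then show ?thesis using that[of 1 0] by auto
  next
    case False
    have "continuous_on (closure K) (\<lambda>x :: real^3. norm x - x$1)"
      by (intro continuous_intros)
    from continuous_attains_inf[OF comp False this]
    obtain x0 where "x0 \<in> closure K" "\<And>x. x \<in> closure K \<Longrightarrow> norm x0 - x0$1 \<le> norm x - x$1"
      by blast
    with that[of "norm x0 - x0$1" B] pos B closure_subset show ?thesis by blast
  qed
qed

theorem proposition1p10:
  fixes b :: real and K :: "(real^3) set"
  assumes "b > 0"
    and "compactly_contained K (UNIV - ell_plus)"
  shows "\<exists>(C::real) (E :: real \<Rightarrow> real^3 \<Rightarrow> real). \<forall>\<^sub>F R in at_top. \<forall>x\<in>K.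
           \<bar>E R x\<bar> \<le> C \<and>
           (\<forall>mu\<in>mu3_values b (R *\<^sub>R x).
              sgn mu \<in> {-1, 1} \<and>
              fb b (R *\<^sub>R x) mu =
                sgn mu * (R^2 * (((x$3)^2 - (x$2)^2) / (2 * b))
                          + R * x$1 / 2 * ln R
                          + R * (norm x / 2 + x$1 * ln (2 * sqrt ((norm x - x$1) / b)))
                          - b / 8 * ln R
                          + E R x))"
proof -
  obtain d B where d: "d > 0" "\<And>x. x \<in> K \<Longrightarrow> d \<le> norm x - x$1"
    and B: "\<And>x. x \<in> K \<Longrightarrow> norm x \<le> B"
    using compactly_contained_ell_plus_complement_bounds[OF assms(2)] by blast
  define main where "main R x = R^2 * (((x$3)^2 - (x$2)^2) / (2 * b))
      + R * x$1 / 2 * ln R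
      + R * (norm x / 2 + x$1 * ln (2 * sqrt ((norm x - x$1) / b)))
      - b / 8 * ln R" for R and x :: "real^3"
  define E where "E R x = fb b (R *\<^sub>R x) (sqrt (lambda3 b (R *\<^sub>R x))) - main R x" for R x
  \<comment> \<open>The estimate leaves the term \<open>- b/4 * ln (2 * sqrt (a / b))\<close> at \<open>a = norm x - x$1\<close>, which is bounded
    because \<open>d \<le> a \<le> 2 * B\<close> on \<open>K\<close>; the bound \<open>L\<close> comes from the two ends of this range.\<close>
  define L where "L = max \<bar>ln (2 * sqrt (d / b))\<bar> \<bar>ln (2 * sqrt (2 * B / b))\<bar>"
  define C where "C = b * (1 + B / d)^2 + b / 4 * L"

  have "\<bar>E R x\<bar> \<le> C \<and> (\<forall>mu\<in>mu3_values b (R *\<^sub>R x).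
      sgn mu \<in> {-1, 1} \<and> fb b (R *\<^sub>R x) mu = sgn mu * (main R x + E R x))"
    if R: "R \<ge> 2 * b / d" and x: "x \<in> K" for R x
  proof -
    define a where "a = norm x - x$1"
    have "R > 0" using R \<open>b > 0\<close> d(1) by (smt (verit) divide_pos_pos)
    have a: "d \<le> a" "a > 0" "a \<le> 2 * B"
      using d x B[OF x] component_le_norm_cart[of x 1] by (force simp: a_def)+
    have aR: "norm (R *\<^sub>R x) - (R *\<^sub>R x)$1 = R * a"
      using \<open>R > 0\<close> by (simp add: a_def algebra_simps)
    have "2 * b \<le> R * d" using R d(1) by (simp add: field_simps)
    also have "\<dots> \<le> R * a" using a \<open>R > 0\<close> by simp
    finally have large: "2 * b \<le> R * a" .
    define lg where "lg = ln (2 * sqrt (a / b))"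
    have lg_eq: "ln (4 * (R * a) / b) / 2 = ln R / 2 + lg"
    proof -
      have "lg = (ln 4 + ln a - ln b) / 2"
        using a \<open>b > 0\<close> ln_realpow[of 2 2] by (simp add: lg_def ln_mult ln_sqrt ln_div)
      then show ?thesis
        using a \<open>b > 0\<close> \<open>R > 0\<close> by (simp add: ln_mult ln_div)
    qed
    have "ln (2 * sqrt (d / b)) \<le> lg" "lg \<le> ln (2 * sqrt (2 * B / b))"
      unfolding lg_def using a d(1) \<open>b > 0\<close> by (auto simp: divide_right_mono)
    then have lg: "\<bar>lg\<bar> \<le> L" unfolding L_def by linarith

    have "\<bar>fb b (R *\<^sub>R x) (sqrt (lambda3 b (R *\<^sub>R x)))
        - (((R * x$3)^2 - (R * x$2)^2) / (2 * b) + R * norm x / 2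
           + (R * x$1 - b/4) * (ln R / 2 + lg))\<bar>
      \<le> b * (1 + R * norm x / (R * a))^2"
      using fb_explicit_estimate[of b "R *\<^sub>R x"] large \<open>b > 0\<close> \<open>R > 0\<close>
      unfolding aR lg_eq by simp
    moreover have "((R * x$3)^2 - (R * x$2)^2) / (2 * b) + R * norm x / 2
        + (R * x$1 - b/4) * (ln R / 2 + lg) = main R x - b / 4 * lg"
      unfolding main_def lg_def[symmetric] a_def[symmetric]
      by (simp add: power_mult_distrib algebra_simps diff_divide_distrib)
    ultimately have "\<bar>E R x + b / 4 * lg\<bar> \<le> b * (1 + norm x / a)^2"
      using \<open>R > 0\<close> by (simp add: E_def algebra_simps)
    also have "\<dots> \<le> b * (1 + B / d)^2"
      using a d(1) B[OF x] \<open>b > 0\<close>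
      by (intro mult_left_mono power_mono add_left_mono frac_le) (auto intro: order_trans[OF norm_ge_zero])
    finally have "\<bar>E R x + b / 4 * lg\<bar> \<le> b * (1 + B / d)^2" .
    moreover have "\<bar>b / 4 * lg\<bar> \<le> b / 4 * L"
      using lg \<open>b > 0\<close> by (simp add: abs_mult)
    ultimately have "\<bar>E R x\<bar> \<le> C" unfolding C_def by linarith
    moreover have "lambda3 b (R *\<^sub>R x) > 0"
      using lambda3_bounds(1)[of b "R *\<^sub>R x"] large \<open>b > 0\<close> unfolding aR by linarith
    ultimately show ?thesis
      using \<open>b > 0\<close> by (auto simp: mu3_values_def E_def fb_odd)
  qed
  then have "\<forall>\<^sub>F R in at_top. \<forall>x\<in>K. \<bar>E R x\<bar> \<le> C \<and> (\<forall>mu\<in>mu3_values b (R *\<^sub>R x).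
      sgn mu \<in> {-1, 1} \<and> fb b (R *\<^sub>R x) mu = sgn mu * (main R x + E R x))"
    by (intro eventually_mono[OF eventually_ge_at_top[of "2 * b / d"]] ballI)
  then show ?thesis unfolding main_def by (intro exI[of _ C] exI[of _ E])
qed

end
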